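(* For every integer $n\ge 2$, $ir_b(P_n)=\gamma_b(P_n)=\left\lceil\frac{n}{3}\right\rceil$, where $P_n$ is the path of order $n$.
   Context: For a graph $G=(V,E)$, a broadcast is a function $f:V\to\{0,\dots,\operatorname{diam}(G)\}$ with $f(v)\le e_G(v)$ (eccentricity) for all $v$. Let $V^+_f=\{v: f(v)>0\}$ and $H_f(u)=\{v\in V^+_f: d_G(u,v)\le f(v)\}$. For $v\in V^+_f$, $PN_f(v)=\{u\in V: H_f(u)=\{v\}\}$, and $PB_f(v)$ is $\{v\}$ if $f(v)=1$ and $PN_f(v)=\{v\}$, and otherwise $PB_f(v)=\{u\in PN_f(v): d_G(u,v)=f(v)\}$. The cost is $\sigma(f)=\sum_v f(v)$. $f$ is dominating if $|H_f(u)|\ge1$ for all $u$; $\gamma_b(G)$ is the minimum cost of a dominating broadcast. $f$ is irredundant if $PB_f(v)\ne\emptyset$ for every $v\in V^+_f$; it is maximal irredundant if no irredundant broadcast $g\ne f$ satisfies $g\ge f$ pointwise; $ir_b(G)$ is the minimum cost of a maximal irredundant broadcast. *)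

theory Defs
  imports Complex_Main "HOL-Library.Extended_Nat" "Graph_Theory.Pair_Digraph"
begin

text \<open>
  Finite simple graphs are the symmetric loop-free digraphs of locale \<^locale>\<open>pair_graph\<close>.
  Distances are \<^typ>\<open>enat\<close>-valued, so vertices in different components are at
  distance \<^term>\<open>\<infinity> :: enat\<close>.
\<close>

definition gdist :: "'a pair_pre_digraph \<Rightarrow> 'a \<Rightarrow> 'a \<Rightarrow> enat" where
  "gdist G u v = (INF p\<in>{p. pre_digraph.awalk (with_proj G) u p v}. enat (length p))"

definition eccentricity :: "'a pair_pre_digraph \<Rightarrow> 'a \<Rightarrow> enat" where
  "eccentricity G v = (SUP u\<in>pverts G. gdist G v u)"

definition diam :: "'a pair_pre_digraph \<Rightarrow> enat" where
  "diam G = (SUP v\<in>pverts G. eccentricity G v)"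

text \<open>
  A broadcast is a total function whose values outside the vertex set are irrelevant:
  every notion below, including the comparison of two broadcasts, refers to vertices only.
\<close>

definition broadcast :: "'a pair_pre_digraph \<Rightarrow> ('a \<Rightarrow> nat) \<Rightarrow> bool" where
  "broadcast G f \<longleftrightarrow>
     (\<forall>v\<in>pverts G. enat (f v) \<le> diam G \<and> enat (f v) \<le> eccentricity G v)"

definition bcast_verts :: "'a pair_pre_digraph \<Rightarrow> ('a \<Rightarrow> nat) \<Rightarrow> 'a set" where
  "bcast_verts G f = {v \<in> pverts G. f v > 0}"

definition hears :: "'a pair_pre_digraph \<Rightarrow> ('a \<Rightarrow> nat) \<Rightarrow> 'a \<Rightarrow> 'a set" where
  "hears G f u = {v \<in> bcast_verts G f. gdist G u v \<le> enat (f v)}"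

definition private_nbhd :: "'a pair_pre_digraph \<Rightarrow> ('a \<Rightarrow> nat) \<Rightarrow> 'a \<Rightarrow> 'a set" where
  "private_nbhd G f v = {u \<in> pverts G. hears G f u = {v}}"

definition private_boundary :: "'a pair_pre_digraph \<Rightarrow> ('a \<Rightarrow> nat) \<Rightarrow> 'a \<Rightarrow> 'a set" where
  "private_boundary G f v =
     (if f v = 1 \<and> private_nbhd G f v = {v} then {v}
      else {u \<in> private_nbhd G f v. gdist G u v = enat (f v)})"

definition bcast_cost :: "'a pair_pre_digraph \<Rightarrow> ('a \<Rightarrow> nat) \<Rightarrow> nat" where
  "bcast_cost G f = (\<Sum>v\<in>pverts G. f v)"

definition dominating_broadcast :: "'a pair_pre_digraph \<Rightarrow> ('a \<Rightarrow> nat) \<Rightarrow> bool" where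
  "dominating_broadcast G f \<longleftrightarrow> broadcast G f \<and> (\<forall>u\<in>pverts G. card (hears G f u) \<ge> 1)"

definition irredundant_broadcast :: "'a pair_pre_digraph \<Rightarrow> ('a \<Rightarrow> nat) \<Rightarrow> bool" where
  "irredundant_broadcast G f \<longleftrightarrow>
     broadcast G f \<and> (\<forall>v\<in>bcast_verts G f. private_boundary G f v \<noteq> {})"

definition maximal_irredundant_broadcast :: "'a pair_pre_digraph \<Rightarrow> ('a \<Rightarrow> nat) \<Rightarrow> bool" where
  "maximal_irredundant_broadcast G f \<longleftrightarrow>
     irredundant_broadcast G f \<and>
     \<not> (\<exists>g. irredundant_broadcast G g \<and> (\<forall>v\<in>pverts G. g v \<ge> f v) \<and> (\<exists>v\<in>pverts G. g v \<noteq> f v))"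

definition broadcast_domination_number :: "'a pair_pre_digraph \<Rightarrow> nat" ("\<gamma>\<^sub>b") where
  "\<gamma>\<^sub>b G = (LEAST c. \<exists>f. dominating_broadcast G f \<and> bcast_cost G f = c)"

definition broadcast_irredundance_number :: "'a pair_pre_digraph \<Rightarrow> nat" ("ir\<^sub>b") where
  "ir\<^sub>b G = (LEAST c. \<exists>f. maximal_irredundant_broadcast G f \<and> bcast_cost G f = c)"

definition path_graph :: "nat \<Rightarrow> nat pair_pre_digraph" where
  "path_graph n =
     \<lparr>pverts = {0..<n}, parcs = {(i, j). i < n \<and> j < n \<and> (j = i + 1 \<or> i = j + 1)}\<rparr>"

lemma pair_graph_path_graph: "pair_graph (path_graph n)"
proof -
  have "finite {(i, j). i < n \<and> j < n \<and> (j = i + 1 \<or> i = j + 1)}"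
    by (rule finite_subset[of _ "{0..<n} \<times> {0..<n}"]) auto
  then show ?thesis
    by unfold_locales (auto simp: path_graph_def symmetric_def intro!: symI)
qed

end

theory Submission
  imports Defs
begin

text \<open>
  A broadcast vertex \<open>v\<close> of a path covers at most \<open>2 f(v) + 1 \<le> 3 f(v)\<close> vertices, which gives
  \<open>n \<le> 3 \<sigma>(f)\<close> for dominating \<open>f\<close>.  If \<open>f\<close> is only maximal irredundant and \<open>u\<close> hears nothing,
  then raising \<open>f(u)\<close> to 1 must destroy the private boundary of some \<open>v\<close>, so \<open>u\<close> is adjacent to
  the only private boundary vertex of \<open>v\<close>; moreover \<open>v\<close> is not its own private neighbour if
  \<open>f(v) = 1\<close>.  Hence every \<open>v\<close> is charged with at most one such \<open>u\<close>.  For \<open>f(v) \<ge> 2\<close> this fits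
  into \<open>2 f(v) + 2 \<le> 3 f(v)\<close>; for \<open>f(v) = 1\<close> one of the neighbours of \<open>v\<close> is already charged to
  another vertex.  Conversely, the broadcast with value 1 at every third vertex is dominating and
  irredundant, and a dominating irredundant broadcast is maximal irredundant.
\<close>

section \<open>Distances, eccentricities and hearing in paths\<close>

lemma pverts_path_graph [simp]: "pverts (path_graph n) = {0..<n}"
  by (simp add: path_graph_def)

text \<open>Each arc changes the vertex by exactly one.\<close>

lemma awalk_path_graph_le:
  assumes "pre_digraph.awalk (with_proj (path_graph n)) u p v"
  shows "u \<le> v + length p \<and> v \<le> u + length p"
proof -
  interpret pair_graph "path_graph n" by (rule pair_graph_path_graph)
  show ?thesis using assms
  proof (induction p arbitrary: u)
    case Nil
    then show ?case by (auto simp: awalk_Nil_iff)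
  next
    case (Cons e p)
    then have "e \<in> parcs (path_graph n)" "fst e = u" "awalk (snd e) p v"
      by (auto simp: awalk_Cons_iff)
    with Cons.IH[of "snd e"] show ?case by (auto simp: path_graph_def)
  qed
qed

text \<open>Of the two truncated differences at least one is 0, so their sum is the absolute
  difference. The walk always steps towards \<open>v\<close>.\<close>

lemma ex_awalk_path_graph:
  assumes "u < n" "v < n"
  shows "\<exists>p. pre_digraph.awalk (with_proj (path_graph n)) u p v \<and> length p = (u - v) + (v - u)"
proof -
  interpret pair_graph "path_graph n" by (rule pair_graph_path_graph)
  have "\<exists>p. awalk u p v \<and> length p = d" if "u < n" "d = (u - v) + (v - u)" for d u
    using that
  proof (induction d arbitrary: u)
    case 0
    then have "awalk u [] v" using assms by (auto simp: awalk_Nil_iff)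
    then show ?case by auto
  next
    case (Suc d)
    \<comment> \<open>The remaining distance is positive, so \<open>u \<noteq> v\<close> and the
      second branch means \<open>u > v\<close>.\<close>
    define u' where "u' = (if u < v then Suc u else u - 1)"
    have "u' < n" "d = (u' - v) + (v - u')"
      using Suc.prems assms by (auto simp: u'_def)
    then obtain p where p: "awalk u' p v" "length p = d" using Suc.IH by blast
    have "(u, u') \<in> parcs (path_graph n)"
      using Suc.prems assms by (auto simp: u'_def path_graph_def)
    then have "awalk u ((u, u') # p) v" using p by (simp add: awalk_Cons_iff)
    then show ?case using p by (intro exI[of _ "(u, u') # p"]) simp
  qed
  then show ?thesis using assms by blast
qed

lemma gdist_path_graph:
  assumes "u < n" "v < n"
  shows "gdist (path_graph n) u v = enat ((u - v) + (v - u))"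
proof -
  obtain p where p: "pre_digraph.awalk (with_proj (path_graph n)) u p v"
    "length p = (u - v) + (v - u)"
    using ex_awalk_path_graph[OF assms] by blast
  show ?thesis unfolding gdist_def
  proof (rule antisym)
    show "(INF p\<in>{p. pre_digraph.awalk (with_proj (path_graph n)) u p v}. enat (length p))
        \<le> enat ((u - v) + (v - u))"
      using p by (intro INF_lower2[of p]) auto
    show "enat ((u - v) + (v - u))
        \<le> (INF p\<in>{p. pre_digraph.awalk (with_proj (path_graph n)) u p v}. enat (length p))"
    proof (rule INF_greatest)
      fix q assume "q \<in> {p. pre_digraph.awalk (with_proj (path_graph n)) u p v}"
      then have "u \<le> v + length q \<and> v \<le> u + length q"
        using awalk_path_graph_le by blast
      then show "enat ((u - v) + (v - u)) \<le> enat (length q)" by auto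
    qed
  qed
qed

text \<open>Any neighbour is a witness. With the same bound for the diameter, this makes the value 1
  admissible at every vertex.\<close>

lemma eccentricity_path_graph_ge_1:
  assumes "n \<ge> 2" "v < n"
  shows "enat 1 \<le> eccentricity (path_graph n) v"
proof -
  define u where "u = (if v = 0 then 1 else v - 1)"
  have "u < n" "(v - u) + (u - v) = 1" using assms by (auto simp: u_def)
  then show ?thesis unfolding eccentricity_def
    using assms by (intro SUP_upper2[of u]) (auto simp: gdist_path_graph)
qed

lemma diam_path_graph_ge_1:
  assumes "n \<ge> 2"
  shows "enat 1 \<le> diam (path_graph n)"
  unfolding diam_def using assms
  by (intro SUP_upper2[of 0] eccentricity_path_graph_ge_1) auto

lemma broadcast_path_graph_upd_1:
  assumes "n \<ge> 2" "broadcast (path_graph n) f"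
  shows "broadcast (path_graph n) (f(u := 1))"
  using assms diam_path_graph_ge_1[OF assms(1)] eccentricity_path_graph_ge_1[OF assms(1)]
  by (auto simp: broadcast_def)

lemma hears_path_graph:
  assumes "u < n"
  shows "hears (path_graph n) f u = {v. v < n \<and> f v > 0 \<and> u \<le> v + f v \<and> v \<le> u + f v}"
  using assms by (auto simp: hears_def bcast_verts_def gdist_path_graph)

lemma gdist_path_graph_eq_iff:
  assumes "u < n" "v < n"
  shows "gdist (path_graph n) u v = enat r \<longleftrightarrow> u = v + r \<or> v = u + r"
  using assms by (auto simp: gdist_path_graph)

section \<open>Covering bound and dominating broadcasts\<close>

text \<open>A union bound in which \<open>S v\<close> is the set of vertices charged to
  \<open>v\<close>. The sets may overlap; both lower bounds are instances with different choices of
  \<open>S\<close>.\<close>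

lemma n_le_3_bcast_cost_path_graph:
  assumes cover: "{0..<n} \<subseteq> (\<Union>v\<in>bcast_verts (path_graph n) f. S v)"
    and card: "\<And>v. v \<in> bcast_verts (path_graph n) f \<Longrightarrow> finite (S v) \<and> card (S v) \<le> 3 * f v"
  shows "n \<le> 3 * bcast_cost (path_graph n) f"
proof -
  let ?B = "bcast_verts (path_graph n) f"
  have fin: "finite ?B" by (simp add: bcast_verts_def)
  have "n = card {0..<n}" by simp
  also have "\<dots> \<le> card (\<Union>v\<in>?B. S v)"
    using cover card fin by (intro card_mono) auto
  also have "\<dots> \<le> (\<Sum>v\<in>?B. card (S v))" using fin by (rule card_UN_le)
  also have "\<dots> \<le> (\<Sum>v\<in>?B. 3 * f v)" using card by (intro sum_mono) blast
  also have "\<dots> \<le> (\<Sum>v\<in>{0..<n}. 3 * f v)"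
    by (intro sum_mono2) (auto simp: bcast_verts_def)
  finally show ?thesis by (simp add: bcast_cost_def sum_distrib_left)
qed

lemma ball_path:
  fixes v r :: nat
  shows "finite {u. u \<le> v + r \<and> v \<le> u + r}"
    and "card {u. u \<le> v + r \<and> v \<le> u + r} \<le> 2 * r + 1"
proof -
  have eq: "{u. u \<le> v + r \<and> v \<le> u + r} = {v - r..v + r}" by auto
  show "finite {u. u \<le> v + r \<and> v \<le> u + r}" "card {u. u \<le> v + r \<and> v \<le> u + r} \<le> 2 * r + 1"
    unfolding eq by auto
qed

lemma dominating_broadcast_hears:
  assumes "dominating_broadcast G f" "u \<in> pverts G"
  shows "hears G f u \<noteq> {}"
proof
  assume "hears G f u = {}"
  then have "card (hears G f u) = 0" by simp
  then show False using assms unfolding dominating_broadcast_def by (metis not_one_le_zero)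
qed

lemma dominating_broadcast_path_graph_cost:
  assumes "dominating_broadcast (path_graph n) f"
  shows "n \<le> 3 * bcast_cost (path_graph n) f"
proof (rule n_le_3_bcast_cost_path_graph)
  let ?S = "\<lambda>v. {u. u \<le> v + f v \<and> v \<le> u + f v}"
  show "{0..<n} \<subseteq> (\<Union>v\<in>bcast_verts (path_graph n) f. ?S v)"
  proof
    fix u assume u: "u \<in> {0..<n}"
    then have "hears (path_graph n) f u \<noteq> {}"
      using dominating_broadcast_hears[OF assms] by simp
    then show "u \<in> (\<Union>v\<in>bcast_verts (path_graph n) f. ?S v)"
      using u by (auto simp: hears_path_graph bcast_verts_def)
  qed
  \<comment> \<open>Here \<open>2 * f v + 1 \<le> 3 * f v\<close> because
    \<open>f v \<ge> 1\<close>.\<close>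
  show "finite (?S v) \<and> card (?S v) \<le> 3 * f v" if "v \<in> bcast_verts (path_graph n) f" for v
    using ball_path[of v "f v"] that by (auto simp: bcast_verts_def)
qed

section \<open>Lower bound for maximal irredundant broadcasts\<close>

text \<open>By maximality \<open>f(u := 1)\<close> is not irredundant, so some \<open>v\<close> has
  an empty private boundary under it. The change is only noticed at distance at most 1 from
  \<open>u\<close>, so every old boundary vertex of \<open>v\<close> must lie there.\<close>

lemma unheard_path_graph_adjacent_boundary:
  assumes n: "n \<ge> 2" and max: "maximal_irredundant_broadcast (path_graph n) f"
    and u: "u < n" "hears (path_graph n) f u = {}"
  obtains v w where "v < n" "f v > 0"
    "w \<in> private_nbhd (path_graph n) f v" "w = v + f v \<or> v = w + f v"
    "\<And>w. w \<in> private_nbhd (path_graph n) f v \<Longrightarrow> w = v + f v \<or> v = w + f v \<Longrightarrow>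
       w = u + 1 \<or> u = w + 1"
    "f v = 1 \<Longrightarrow> v \<notin> private_nbhd (path_graph n) f v"
proof -
  let ?P = "path_graph n"
  define g where "g = f(u := 1)"
  have irr: "irredundant_broadcast ?P f"
    using max by (simp add: maximal_irredundant_broadcast_def)
  have unheard: "\<not> (u \<le> x + f x \<and> x \<le> u + f x)" if "x < n" "f x > 0" for x
    using u that by (auto simp: hears_path_graph)
  have fu: "f u = 0"
    using unheard[of u] u by auto
  have bg: "broadcast ?P g"
    using irr n unfolding g_def irredundant_broadcast_def
    by (intro broadcast_path_graph_upd_1) auto
  have "\<not> irredundant_broadcast ?P g"
  proof
    assume "irredundant_broadcast ?P g"
    moreover have "\<forall>v\<in>pverts ?P. g v \<ge> f v" "g u \<noteq> f u" "u \<in> pverts ?P"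
      using fu u by (auto simp: g_def)
    ultimately show False
      using max unfolding maximal_irredundant_broadcast_def by blast
  qed
  then obtain v where v: "v \<in> bcast_verts ?P g" and vB: "private_boundary ?P g v = {}"
    using bg unfolding irredundant_broadcast_def by blast
  have vn: "v < n" using v by (auto simp: bcast_verts_def)
  have hg: "hears ?P g x = hears ?P f x \<union> (if x \<le> u + 1 \<and> u \<le> x + 1 then {u} else {})"
    if "x < n" for x
    using that u fu by (auto simp: hears_path_graph g_def split: if_splits)
  \<comment> \<open>Otherwise, since the boundary is empty, \<open>v\<close> has a second private
    neighbour; it is at distance exactly 1 and hence in the boundary.\<close>
  have self: "v \<notin> private_nbhd ?P g v" if "g v = 1"
  proof
    assume a: "v \<in> private_nbhd ?P g v"
    with vB that obtain x where x: "x \<in> private_nbhd ?P g v" "x \<noteq> v"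
      by (auto simp: private_boundary_def split: if_splits)
    then have "x < n" "v \<in> hears ?P g x" by (auto simp: private_nbhd_def)
    then have "gdist ?P x v = enat (g v)"
      using x(2) that vn by (auto simp: hears_path_graph gdist_path_graph_eq_iff)
    then show False using x vB that by (auto simp: private_boundary_def split: if_splits)
  qed
  \<comment> \<open>Under \<open>g\<close> the vertex \<open>u\<close> hears only itself, which
    \<open>self\<close> excludes for \<open>v = u\<close>.\<close>
  have uv: "v \<noteq> u"
  proof
    assume "v = u"
    moreover have "u \<in> private_nbhd ?P g u"
      using u by (simp add: private_nbhd_def hg)
    ultimately show False using self by (simp add: g_def)
  qed
  then have gv: "g v = f v" by (simp add: g_def)
  have fv: "f v > 0" using v gv by (simp add: bcast_verts_def)
  have far: "\<not> (u \<le> v + f v \<and> v \<le> u + f v)"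
    using unheard vn fv by blast
  have pn: "x \<in> private_nbhd ?P g v"
    if "x \<in> private_nbhd ?P f v" "\<not> (x \<le> u + 1 \<and> u \<le> x + 1)" for x
    using that hg[of x] unfolding private_nbhd_def by (simp only: mem_Collect_eq if_False) simp
  \<comment> \<open>If \<open>f v = 1\<close>, then \<open>far\<close> puts \<open>v\<close> at
    distance more than 1 from \<open>u\<close>, so \<open>v\<close> hears the same under
    \<open>f\<close> and \<open>g\<close>.\<close>
  have nself: "v \<notin> private_nbhd ?P f v" if "f v = 1"
    using self pn[of v] far that gv by auto
  have adj: "w = u + 1 \<or> u = w + 1"
    if w: "w \<in> private_nbhd ?P f v" "w = v + f v \<or> v = w + f v" for w
  proof -
    have wn: "w < n" using w by (simp add: private_nbhd_def)
    have "w \<notin> private_nbhd ?P g v"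
    proof
      assume "w \<in> private_nbhd ?P g v"
      moreover have "gdist ?P w v = enat (g v)"
        using w wn vn gv by (simp add: gdist_path_graph_eq_iff)
      ultimately show False using vB by (auto simp: private_boundary_def split: if_splits)
    qed
    then have "w \<le> u + 1 \<and> u \<le> w + 1" using pn w by blast
    moreover have "w \<noteq> u" using far w by auto
    ultimately show ?thesis by auto
  qed
  \<comment> \<open>By \<open>nself\<close> the special clause for value 1 does not apply, so a
    boundary vertex is at distance exactly \<open>f v\<close>.\<close>
  have "private_boundary ?P f v \<noteq> {}"
    using irr vn fv by (auto simp: irredundant_broadcast_def bcast_verts_def)
  then obtain w where "w \<in> private_nbhd ?P f v" "gdist ?P w v = enat (f v)"
    using nself by (auto simp: private_boundary_def split: if_splits)
  moreover from this have "w = v + f v \<or> v = w + f v"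
    using vn by (simp add: gdist_path_graph_eq_iff private_nbhd_def)
  ultimately show thesis using that[of v w] vn fv adj nself by blast
qed

lemma maximal_irredundant_broadcast_path_graph_cost:
  assumes n: "n \<ge> 2" and max: "maximal_irredundant_broadcast (path_graph n) f"
  shows "n \<le> 3 * bcast_cost (path_graph n) f"
proof -
  let ?P = "path_graph n"
  define PN where "PN = private_nbhd ?P f"
  define N where "N = (\<lambda>v. {u. u \<le> v + f v \<and> v \<le> u + f v})"
  define B where "B = (\<lambda>v. {w \<in> PN v. w = v + f v \<or> v = w + f v})"
  \<comment> \<open>\<open>U v\<close> holds the unheard vertices charged to \<open>v\<close>.
    Requiring \<open>B v\<close> to be nonempty keeps the universal condition from being
    vacuous.\<close>
  define U where "U = (\<lambda>v. {u. u < n \<and> hears ?P f u = {} \<and> B v \<noteq> {} \<and>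
    (\<forall>w\<in>B v. w = u + 1 \<or> u = w + 1) \<and> (f v = 1 \<longrightarrow> v \<notin> PN v)})"
  \<comment> \<open>\<open>D v\<close> holds the heard vertices charged to \<open>v\<close>. If
    \<open>f v = 1\<close> and \<open>U v\<close> is nonempty, charging the whole ball could give 4
    vertices, so only \<open>v\<close> and its private neighbours are kept.\<close>
  define D where "D = (\<lambda>v. if U v = {} \<or> f v \<ge> 2 then N v else insert v (PN v))"
  have PN_N: "w \<in> N v" if "w \<in> PN v" for v w
  proof -
    have "w < n" "v \<in> hears ?P f w" using that by (auto simp: PN_def private_nbhd_def)
    then show ?thesis by (simp add: hears_path_graph N_def)
  qed
  have PN_n: "w < n" if "w \<in> PN v" for v w
    using that by (auto simp: PN_def private_nbhd_def)
  have PN_unique: "v' = v" if "w \<in> PN v" "v' < n" "f v' > 0" "w \<in> N v'" for v v' w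
  proof -
    have "v' \<in> hears ?P f w"
      using that PN_n[OF that(1)] by (simp add: hears_path_graph N_def)
    then show ?thesis using that(1) by (simp add: PN_def private_nbhd_def)
  qed
  have U_far: "u \<notin> N v" if "u \<in> U v" "v < n" "f v > 0" for u v
  proof -
    have "u < n" "v \<notin> hears ?P f u" using that by (auto simp: U_def)
    then show ?thesis using that by (simp add: hears_path_graph N_def)
  qed
  have U_card: "finite (U v) \<and> card (U v) \<le> 1" if v: "v < n" "f v > 0" for v
  proof -
    \<comment> \<open>Both are adjacent to \<open>w\<close>, which is at distance \<open>f v\<close>
      from \<open>v\<close>, and both lie outside the ball: each is the vertex just beyond
      \<open>w\<close>.\<close>
    have "u = u'" if "u \<in> U v" "u' \<in> U v" for u u'
    proof -
      obtain w where "w \<in> B v" using \<open>u \<in> U v\<close> by (auto simp: U_def)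
      then have "w = v + f v \<or> v = w + f v" "w = u + 1 \<or> u = w + 1" "w = u' + 1 \<or> u' = w + 1"
        using that by (auto simp: U_def B_def)
      moreover have "u \<notin> N v" "u' \<notin> N v" using that U_far v by auto
      ultimately show ?thesis using v unfolding N_def mem_Collect_eq by linarith
    qed
    moreover have "finite (U v)" by (simp add: U_def)
    ultimately show ?thesis by (metis One_nat_def card_le_Suc0_iff_eq)
  qed
  have PN_B: "PN v = B v" if "U v \<noteq> {}" "f v = 1" for v
  proof -
    have "v \<notin> PN v" using that by (auto simp: U_def)
    have "w = v + f v \<or> v = w + f v" if w: "w \<in> PN v" for w
    proof -
      have "w \<noteq> v" using w \<open>v \<notin> PN v\<close> by blast
      then show ?thesis using PN_N[OF w] \<open>f v = 1\<close> by (auto simp: N_def)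
    qed
    then show ?thesis by (auto simp: B_def)
  qed
  have PN_card: "card (PN v) \<le> 1" if v: "v < n" "f v > 0" "U v \<noteq> {}" "f v = 1" for v
  proof -
    obtain u where u: "u \<in> U v" using v by auto
    \<comment> \<open>Distinct \<open>w\<close> and \<open>w'\<close> would be the two neighbours of
      \<open>v\<close>, and their only common neighbour \<open>v\<close> is in the ball, unlike
      \<open>u\<close>.\<close>
    have "w = w'" if "w \<in> B v" "w' \<in> B v" for w w'
    proof -
      have "w = v + f v \<or> v = w + f v" "w' = v + f v \<or> v = w' + f v"
        "w = u + 1 \<or> u = w + 1" "w' = u + 1 \<or> u = w' + 1"
        using that u by (auto simp: U_def B_def)
      moreover have "u \<notin> N v" using u U_far v by auto
      ultimately show ?thesis using v unfolding N_def mem_Collect_eq by linarith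
    qed
    moreover have "finite (PN v)" by (simp add: PN_def private_nbhd_def)
    ultimately show ?thesis using PN_B[OF v(3,4)] by (metis One_nat_def card_le_Suc0_iff_eq)
  qed
  show ?thesis
  proof (rule n_le_3_bcast_cost_path_graph)
    fix v assume "v \<in> bcast_verts ?P f"
    then have v: "v < n" "f v > 0" by (auto simp: bcast_verts_def)
    have N: "finite (N v)" "card (N v) \<le> 2 * f v + 1" unfolding N_def by (rule ball_path)+
    have "finite (PN v)" by (simp add: PN_def private_nbhd_def)
    then have fin: "finite (D v)" using N by (simp add: D_def)
    \<comment> \<open>The bounds are \<open>2 * f v + 1\<close> if \<open>U v\<close> is empty,
      \<open>2 * f v + 2\<close> if \<open>f v \<ge> 2\<close>, and 2 + 1 in the remaining
      case.\<close>
    have "card (D v) + card (U v) \<le> 3 * f v"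
    proof (cases "U v = {} \<or> f v \<ge> 2")
      case True
      then show ?thesis using N U_card[OF v] v by (auto simp: D_def)
    next
      case False
      then have "f v = 1" using v by auto
      then show ?thesis using False PN_card[OF v] U_card[OF v]
          card_insert_le_m1[of 2 "PN v" v] by (auto simp: D_def)
    qed
    then show "finite (D v \<union> U v) \<and> card (D v \<union> U v) \<le> 3 * f v"
      using fin U_card[OF v] card_Un_le[of "D v" "U v"] by auto
  next
    show "{0..<n} \<subseteq> (\<Union>v\<in>bcast_verts ?P f. D v \<union> U v)"
    proof
      fix x assume "x \<in> {0..<n}"
      then have x: "x < n" by simp
      have "\<exists>v. v < n \<and> f v > 0 \<and> x \<in> D v \<union> U v"
      proof (cases "hears ?P f x = {}")
        case True
        from unheard_path_graph_adjacent_boundary[OF n max x True]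
        obtain v w where v: "v < n" "f v > 0"
          "w \<in> PN v" "w = v + f v \<or> v = w + f v"
          "\<And>w. w \<in> PN v \<Longrightarrow> w = v + f v \<or> v = w + f v \<Longrightarrow> w = x + 1 \<or> x = w + 1"
          "f v = 1 \<Longrightarrow> v \<notin> PN v"
          unfolding PN_def by metis
        then have "x \<in> U v" using x True by (auto simp: U_def B_def)
        then show ?thesis using v by blast
      next
        case False
        then obtain v where v: "v < n" "f v > 0" "x \<in> N v"
          using x by (auto simp: hears_path_graph N_def)
        show ?thesis
        proof (cases "x \<in> D v")
          case True
          then show ?thesis using v by blast
        next
          case False
          then have Uv: "U v \<noteq> {}" "f v = 1" and xv: "x \<noteq> v" "x \<notin> PN v"
            using v by (auto simp: D_def split: if_splits)
          obtain w where w: "w \<in> PN v" "w = v + 1 \<or> v = w + 1"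
            using Uv by (auto simp: U_def B_def)
          \<comment> \<open>As \<open>v\<close> is not its own private neighbour, it hears a second
            vertex \<open>v'\<close>, to which \<open>x\<close> gets charged.\<close>
          have "v \<notin> PN v" using Uv by (auto simp: U_def)
          moreover have "v \<in> hears ?P f v" using v by (simp add: hears_path_graph)
          ultimately obtain v' where v': "v' \<in> hears ?P f v" "v' \<noteq> v"
            using v(1) by (auto simp: PN_def private_nbhd_def)
          then have v'n: "v' < n" "f v' > 0" "v \<in> N v'"
            using v by (auto simp: hears_path_graph N_def)
          then have "w \<notin> N v'" using PN_unique[OF w(1)] v'(2) by blast
          moreover have "x \<noteq> w" using xv w by auto
          \<comment> \<open>So \<open>N v'\<close> ends at \<open>v\<close>, on the side of \<open>v\<close> opposite to \<open>w\<close>, where \<open>x\<close> is.\<close>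
          ultimately have "x \<in> N v' \<and> (f v' = 1 \<longrightarrow> x = v')"
            using w(2) v'n v(3) Uv(2) xv(1) v'(2) unfolding N_def mem_Collect_eq by linarith
          \<comment> \<open>If \<open>f v' \<ge> 2\<close>, then \<open>D v'\<close> is the whole
            ball; if \<open>f v' = 1\<close>, then \<open>x\<close> is the centre, which
            \<open>D v'\<close> always contains.\<close>
          then have "x \<in> D v'" using v'n by (auto simp: D_def)
          then show ?thesis using v'n by blast
        qed
      qed
      then show "x \<in> (\<Union>v\<in>bcast_verts ?P f. D v \<union> U v)"
        by (auto simp: bcast_verts_def)
    qed
  qed
qed

section \<open>Dominating irredundant broadcasts and the upper bound\<close>

text \<open>Where \<open>g\<close> exceeds \<open>f\<close> at \<open>v\<close>, a private boundary
  vertex \<open>u\<close> of \<open>v\<close> under \<open>g\<close> hears some \<open>w\<close>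
  under \<open>f\<close>, hence also under \<open>g\<close>, so \<open>w = v\<close>. But then
  \<open>u\<close> is within \<open>f v < g v\<close> of \<open>v\<close> and
  \<open>f v > 0\<close>, which is impossible in a private boundary.\<close>

lemma dominating_irredundant_imp_maximal_irredundant:
  assumes dom: "dominating_broadcast G f" and irr: "irredundant_broadcast G f"
  shows "maximal_irredundant_broadcast G f"
  unfolding maximal_irredundant_broadcast_def
proof (intro conjI notI)
  show "irredundant_broadcast G f" by fact
  assume "\<exists>g. irredundant_broadcast G g \<and> (\<forall>v\<in>pverts G. g v \<ge> f v) \<and> (\<exists>v\<in>pverts G. g v \<noteq> f v)"
  then obtain g v where g: "irredundant_broadcast G g" "\<And>v. v \<in> pverts G \<Longrightarrow> g v \<ge> f v"
    and v: "v \<in> pverts G" "g v \<noteq> f v" by blast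
  then have less: "f v < g v" by (metis order_le_less)
  then obtain u where u: "u \<in> private_boundary G g v"
    using g(1) v by (fastforce simp: irredundant_broadcast_def bcast_verts_def)
  \<comment> \<open>The special clause of \<open>private_boundary\<close> yields no distance; there
    \<open>g v = 1\<close> forces \<open>f v = 0\<close>, against \<open>f w > 0\<close>.\<close>
  then have up: "u \<in> private_nbhd G g v" and ud: "gdist G u v = enat (g v) \<or> g v = 1"
    by (auto simp: private_boundary_def split: if_splits)
  then have "u \<in> pverts G" by (simp add: private_nbhd_def)
  then have "hears G f u \<noteq> {}" by (rule dominating_broadcast_hears[OF dom])
  then obtain w where w: "w \<in> pverts G" "f w > 0" "gdist G u w \<le> enat (f w)"
    by (auto simp: hears_def bcast_verts_def)
  then have "w \<in> hears G g u"
    using g(2)[OF w(1)] order_trans[of "gdist G u w" "enat (f w)" "enat (g w)"]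
    by (auto simp: hears_def bcast_verts_def)
  then have "w = v" using up by (auto simp: private_nbhd_def)
  then show False using w ud less by auto
qed

lemma ex_dominating_irredundant_broadcast_path_graph:
  assumes n: "n \<ge> 2"
  obtains f where "dominating_broadcast (path_graph n) f" "irredundant_broadcast (path_graph n) f"
    "bcast_cost (path_graph n) f \<le> (n + 2) div 3"
proof -
  let ?P = "path_graph n"
  \<comment> \<open>The middles of consecutive blocks of three, plus the last vertex when it forms a
    block of its own.\<close>
  define A where "A = {v. v < n \<and> (v mod 3 = 1 \<or> v mod 3 = 0 \<and> v + 1 = n)}"
  define f :: "nat \<Rightarrow> nat" where "f v = (if v \<in> A then 1 else 0)" for v
  have An: "v < n" if "v \<in> A" for v using that by (simp add: A_def)
  have h: "hears ?P f u = {v \<in> A. u \<le> v + 1 \<and> v \<le> u + 1}" if "u < n" for u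
    using that An by (auto simp: hears_path_graph f_def)
  have b: "broadcast ?P f"
    using diam_path_graph_ge_1[OF n] eccentricity_path_graph_ge_1[OF n]
    by (auto simp: broadcast_def f_def zero_enat_def[symmetric])
  have "dominating_broadcast ?P f"
    unfolding dominating_broadcast_def
  proof (intro conjI ballI b)
    fix u assume "u \<in> pverts ?P"
    then have u: "u < n" by simp
    \<comment> \<open>The middle of the block of \<open>u\<close>; if it is outside the path,
      \<open>u\<close> is the last vertex and belongs to \<open>A\<close>.\<close>
    define v where "v = (if 3 * (u div 3) + 1 < n then 3 * (u div 3) + 1 else u)"
    have "v < n" "v mod 3 = 1 \<or> v mod 3 = 0 \<and> v + 1 = n" "u \<le> v + 1" "v \<le> u + 1"
      using u unfolding v_def by (auto, presburger+)
    then have "hears ?P f u \<noteq> {}" using u by (auto simp: h A_def)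
    moreover have "finite (hears ?P f u)" using u by (simp add: hears_path_graph)
    ultimately show "1 \<le> card (hears ?P f u)" by (simp add: Suc_le_eq card_gt_0_iff)
  qed
  moreover have "irredundant_broadcast ?P f"
    unfolding irredundant_broadcast_def
  proof (intro conjI ballI b)
    fix v assume "v \<in> bcast_verts ?P f"
    then have v: "v \<in> A" by (auto simp: bcast_verts_def f_def split: if_splits)
    have vn: "v < n" and f1: "f v = 1" using v An by (auto simp: f_def)
    show "private_boundary ?P f v \<noteq> {}"
    proof (cases "v mod 3 = 1")
      case True
      then have w: "v - 1 < n" "v = (v - 1) + 1" using vn by auto
      \<comment> \<open>The first vertex of the block is private to \<open>v\<close>: the vertex
        before it has residue 2, and it is not the last vertex itself.\<close>
      have "hears ?P f (v - 1) = {v}"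
      proof -
        have "x = v" if x: "x \<in> A" "v - 1 \<le> x + 1" "x \<le> v - 1 + 1" for x
        proof -
          consider "x = v" | "x + 1 = v" | "x + 2 = v" using x w by linarith
          then show ?thesis
          proof cases
            case 2
            then have "x mod 3 = 0" "x + 1 \<noteq> n" using True vn by presburger+
            then show ?thesis using x(1) by (simp add: A_def)
          next
            case 3
            then have "x mod 3 = 2" using True by presburger
            then show ?thesis using x(1) by (simp add: A_def)
          qed
        qed
        then show ?thesis using v w h by auto
      qed
      then have "v - 1 \<in> private_nbhd ?P f v" using w by (simp add: private_nbhd_def)
      moreover have "gdist ?P (v - 1) v = enat (f v)"
        using w vn f1 by (simp add: gdist_path_graph_eq_iff)
      ultimately show ?thesis by (auto simp: private_boundary_def)
    next
      case False
      \<comment> \<open>Here \<open>v - 1\<close> also hears \<open>v - 2\<close>, so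
        \<open>v\<close> is its own only private neighbour and the special clause for value 1
        applies.\<close>
      then have v3: "v mod 3 = 0" "v + 1 = n" using v by (auto simp: A_def)
      have v2: "v \<ge> 2" using v3 n by presburger
      have A2: "v - 2 \<in> A"
      proof -
        obtain k where "v = 3 * k" using v3 by (metis mod_0_imp_dvd dvdE)
        then obtain k where "v = 3 * Suc k" using v2 by (cases k) auto
        then have "v - 2 = 1 + 3 * k" by simp
        then show ?thesis using vn by (simp add: A_def)
      qed
      have last: "y = v" if "y \<in> A" "v \<le> y + 1" for y
      proof -
        have "y = v \<or> y + 1 = v" using that An[of y] v3(2) by auto
        moreover have "y + 1 \<noteq> v"
        proof
          assume "y + 1 = v"
          then have "y mod 3 = 2" using v3(1) by presburger
          then show False using that by (simp add: A_def)
        qed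
        ultimately show ?thesis by auto
      qed
      have "x = v" if x: "x \<in> private_nbhd ?P f v" for x
      proof (rule ccontr)
        assume "x \<noteq> v"
        have xn: "x < n" and hx: "hears ?P f x = {v}" using x by (auto simp: private_nbhd_def)
        have "v \<in> hears ?P f x" using hx by simp
        then have "x + 1 = v" using \<open>x \<noteq> v\<close> v3(2) xn by (simp add: h)
        then have "v - 2 \<in> hears ?P f x" using A2 xn v2 by (auto simp: h)
        then show False using hx v2 by auto
      qed
      moreover have "v \<in> private_nbhd ?P f v"
      proof -
        have "hears ?P f v = {v}" unfolding h[OF vn] using v last by auto
        then show ?thesis using vn by (simp add: private_nbhd_def)
      qed
      ultimately have "private_nbhd ?P f v = {v}" by blast
      then show ?thesis using f1 by (simp add: private_boundary_def)
    qed
  qed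
  moreover have "bcast_cost ?P f \<le> (n + 2) div 3"
  proof -
    have "bcast_cost ?P f = card ({0..<n} \<inter> A)"
      by (simp add: bcast_cost_def f_def sum.If_cases)
    also have "{0..<n} \<inter> A = A" using An by auto
    also have "card A \<le> card {..<(n + 2) div 3}"
    \<comment> \<open>Each block of three contains at most one vertex of \<open>A\<close>.\<close>
    proof (rule card_inj_on_le[of "\<lambda>v. v div 3"])
      show "inj_on (\<lambda>v. v div 3) A"
      proof (rule inj_onI)
        fix x y assume xy: "x \<in> A" "y \<in> A" "x div 3 = y div 3"
        have "x = 3 * (y div 3) + x mod 3" "y = 3 * (y div 3) + y mod 3"
          using xy(3) mult_div_mod_eq[of 3 x] mult_div_mod_eq[of 3 y] by simp_all
        moreover have "x < n" "y < n" "x mod 3 = 1 \<or> x mod 3 = 0 \<and> x + 1 = n"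
          "y mod 3 = 1 \<or> y mod 3 = 0 \<and> y + 1 = n"
          using xy by (auto simp: A_def)
        ultimately show "x = y" by (elim disjE conjE) linarith+
      qed
      show "(\<lambda>v. v div 3) ` A \<subseteq> {..<(n + 2) div 3}"
        unfolding A_def by auto
    qed simp
    finally show ?thesis by simp
  qed
  ultimately show thesis using that by blast
qed

theorem theorem3p12:
  fixes n :: nat
  assumes "n \<ge> 2"
  shows "ir\<^sub>b (path_graph n) = \<gamma>\<^sub>b (path_graph n) \<and>
         int (\<gamma>\<^sub>b (path_graph n)) = \<lceil>real n / 3\<rceil>"
proof -
  let ?P = "path_graph n"
  obtain f where f: "dominating_broadcast ?P f" "irredundant_broadcast ?P f"
    and cost: "bcast_cost ?P f \<le> (n + 2) div 3"
    using ex_dominating_irredundant_broadcast_path_graph[OF assms] by blast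
  \<comment> \<open>\<open>(n + 2) div 3\<close> is the rounded-up third of \<open>n\<close>, so the
    lower bound for dominating broadcasts gives equality.\<close>
  have cost_eq: "bcast_cost ?P f = (n + 2) div 3"
    using cost dominating_broadcast_path_graph_cost[OF f(1)] by linarith
  have dom: "\<gamma>\<^sub>b ?P = (n + 2) div 3"
    unfolding broadcast_domination_number_def
  proof (rule Least_equality)
    show "\<exists>f. dominating_broadcast ?P f \<and> bcast_cost ?P f = (n + 2) div 3"
      using f cost_eq by blast
    show "(n + 2) div 3 \<le> c" if "\<exists>f. dominating_broadcast ?P f \<and> bcast_cost ?P f = c" for c
      using that dominating_broadcast_path_graph_cost[of n] by fastforce
  qed
  have irr: "ir\<^sub>b ?P = (n + 2) div 3"
    unfolding broadcast_irredundance_number_def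
  proof (rule Least_equality)
    show "\<exists>f. maximal_irredundant_broadcast ?P f \<and> bcast_cost ?P f = (n + 2) div 3"
      using f cost_eq dominating_irredundant_imp_maximal_irredundant by blast
    show "(n + 2) div 3 \<le> c"
      if "\<exists>f. maximal_irredundant_broadcast ?P f \<and> bcast_cost ?P f = c" for c
      using that maximal_irredundant_broadcast_path_graph_cost[OF assms] by fastforce
  qed
  have "\<lceil>real n / 3\<rceil> = int ((n + 2) div 3)"
  proof (rule ceiling_unique)
    have "n \<le> 3 * ((n + 2) div 3)" "3 * ((n + 2) div 3) < n + 3" by linarith+
    then have "real n \<le> 3 * real ((n + 2) div 3)" "3 * real ((n + 2) div 3) < real n + 3"
      by linarith+
    then show "real n / 3 \<le> of_int (int ((n + 2) div 3))"
      "of_int (int ((n + 2) div 3)) - 1 < real n / 3" by (simp_all add: field_simps)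
  qed
  then show ?thesis using dom irr by simp
qed

end
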